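(* There exists a universal constant $C>0$ such that, for all integers $q\ge2$, $d\ge0$, $N\ge1$, and every polynomial $P\in\mathcal B_{\le d,q}(\mathbb T^N)$, one has $$\|P\|_{L_\infty(\mathbb T^N)}\le (C\log q)^d\,\|P\|_{L_\infty(C_q^N)}.$$
   Context: $\mathbb T=\{z\in\mathbb C:|z|=1\}$ and $C_q=\{e^{2\pi i j/q}:0\le j\le q-1\}\subset\mathbb T$. For $\alpha\in\{0,\ldots,q-1\}^N$, $z^\alpha=z_1^{\alpha_1}\cdots z_N^{\alpha_N}$ and $\operatorname{supp}(\alpha)=\{j:\alpha_j\ne0\}$. $\mathcal B_{\le d,q}(\mathbb T^N)=\operatorname{span}_{\mathbb C}\{z^\alpha:\alpha\in\{0,\ldots,q-1\}^N,\ |\operatorname{supp}(\alpha)|\le d\}\subset C(\mathbb T^N)$. $\|P\|_{L_\infty(K)}=\sup_{z\in K}|P(z)|$ for $K=\mathbb T^N$ or $K=C_q^N\subset\mathbb T^N$. *)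

theory Defs
  imports "HOL-Analysis.Analysis" "HOL-Library.Function_Algebras"
begin

text \<open>
  The dimension is quantified inside the statement, so a point of \<open>K^N\<close> is an
  extensional function on \<open>{..<N}\<close>, with coordinates indexed from 0.
\<close>

definition cart_power :: "complex set \<Rightarrow> nat \<Rightarrow> (nat \<Rightarrow> complex) set"
  where "cart_power K N = (\<Pi>\<^sub>E j\<in>{..<N}. K)"

definition unit_circle :: "complex set"
  where "unit_circle = {z. cmod z = 1}"

definition roots_of_one :: "nat \<Rightarrow> complex set"
  where "roots_of_one q = (\<lambda>j. exp (2 * of_real pi * \<i> * of_nat j / of_nat q)) ` {..<q}"

definition multi_indices :: "nat \<Rightarrow> nat \<Rightarrow> (nat \<Rightarrow> nat) set"
  where "multi_indices q N = (\<Pi>\<^sub>E j\<in>{..<N}. {..<q})"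

definition index_supp :: "nat \<Rightarrow> (nat \<Rightarrow> nat) \<Rightarrow> nat set"
  where "index_supp N \<alpha> = {j\<in>{..<N}. \<alpha> j \<noteq> 0}"

text \<open>
  Elements of \<open>C(T^N)\<close> are represented by functions extended by 0 off \<open>T^N\<close>, so that
  equality of representatives is equality on \<open>T^N\<close>.
\<close>

definition torus_monomial :: "nat \<Rightarrow> (nat \<Rightarrow> nat) \<Rightarrow> (nat \<Rightarrow> complex) \<Rightarrow> complex"
  where "torus_monomial N \<alpha> =
    (\<lambda>z. if z \<in> cart_power unit_circle N then \<Prod>j<N. z j ^ \<alpha> j else 0)"

definition fun_scale :: "complex \<Rightarrow> ('a \<Rightarrow> complex) \<Rightarrow> 'a \<Rightarrow> complex"
  where "fun_scale c f = (\<lambda>z. c * f z)"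

interpretation complex_fun: vector_space "fun_scale :: complex \<Rightarrow> ('a \<Rightarrow> complex) \<Rightarrow> 'a \<Rightarrow> complex"
  by unfold_locales (auto simp: fun_scale_def fun_eq_iff algebra_simps)

definition poly_space :: "nat \<Rightarrow> nat \<Rightarrow> nat \<Rightarrow> ((nat \<Rightarrow> complex) \<Rightarrow> complex) set"
  where "poly_space d q N =
    complex_fun.span (torus_monomial N ` {\<alpha> \<in> multi_indices q N. card (index_supp N \<alpha>) \<le> d})"

text \<open>
  A supremum of reals, hence meaningful only for \<open>K\<close> nonempty and \<open>P\<close> bounded on \<open>K\<close>;
  the last lemma below gives this for elements of \<open>poly_space\<close>.
\<close>

definition sup_norm_on :: "'a set \<Rightarrow> ('a \<Rightarrow> complex) \<Rightarrow> real"
  where "sup_norm_on K P = (SUP z\<in>K. cmod (P z))"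

lemma roots_of_one_subset: "roots_of_one q \<subseteq> unit_circle"
proof
  fix x assume "x \<in> roots_of_one q"
  then obtain j where "x = exp (2 * of_real pi * \<i> * of_nat j / of_nat q)"
    by (auto simp: roots_of_one_def)
  then show "x \<in> unit_circle"
    by (simp add: unit_circle_def norm_exp_eq_Re)
qed

lemma poly_space_bounded:
  assumes "P \<in> poly_space d q N"
  shows "bdd_above ((\<lambda>z. cmod (P z)) ` K)"
proof -
  have "\<exists>B. \<forall>z. cmod (P z) \<le> B"
    using assms unfolding poly_space_def
  proof (induction rule: complex_fun.span_induct_alt)
    case base
    show ?case by (auto simp: zero_fun_def)
  next
    case (step c f g)
    then obtain \<alpha> B where f: "f = torus_monomial N \<alpha>" and B: "\<And>z. cmod (g z) \<le> B"
      by blast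
    have "cmod (f z) \<le> 1" for z
      by (auto simp: f torus_monomial_def cart_power_def unit_circle_def norm_power PiE_iff
          simp flip: prod_norm)
    then have "cmod ((fun_scale c f + g) z) \<le> cmod c * 1 + B" for z
      using B[of z] unfolding plus_fun_def fun_scale_def
      by (intro norm_triangle_le add_mono) (auto simp: norm_mult intro: mult_left_le)
    then show ?case by blast
  qed
  then show ?thesis by (auto simp: bdd_above_def)
qed

lemma norms_well_defined:
  assumes "q \<ge> 1" "P \<in> poly_space d q N" "K = unit_circle \<or> K = roots_of_one q"
  shows "cart_power K N \<noteq> {}" "cart_power K N \<subseteq> cart_power unit_circle N"
    and "bdd_above ((\<lambda>z. cmod (P z)) ` cart_power K N)"
proof -
  have "1 \<in> unit_circle" "roots_of_one q \<noteq> {}"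
    using assms(1) by (auto simp: unit_circle_def roots_of_one_def lessThan_empty_iff)
  then show "cart_power K N \<noteq> {}"
    using assms(3) unfolding cart_power_def PiE_eq_empty_iff by auto
  show "cart_power K N \<subseteq> cart_power unit_circle N"
    using assms(3) roots_of_one_subset unfolding cart_power_def by (auto intro!: PiE_mono)
  show "bdd_above ((\<lambda>z. cmod (P z)) ` cart_power K N)"
    using assms(2) by (rule poly_space_bounded)
qed

end

theory Submission
  imports Defs "HOL-Complex_Analysis.Conformal_Mappings" "HOL-Computational_Algebra.Polynomial"
begin

text \<open>
  For a point \<open>z\<close> of the torus, polynomials of degree below \<open>q\<close> in each variable are evaluated
  at \<open>z\<close> by the product of the interpolation weights \<open>\<mu>\<^sub>j\<close> on the \<open>q\<close>-th roots of unity,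
  whose total variation is at most \<open>4 + 2 ln q\<close>.  Using the product directly would cost this
  factor once per coordinate.  Instead split \<open>\<mu>\<^sub>j = \<nu>\<^sub>j + \<sigma>\<^sub>j\<close>, where
  \<open>\<nu>\<^sub>j\<close> is \<open>\<bar>\<mu>\<^sub>j\<bar>\<close> normalised to total mass 1, so that \<open>\<sigma>\<^sub>j\<close> has mass 0 and
  \<open>\<bar>\<sigma>\<^sub>j\<bar> \<le> B \<nu>\<^sub>j\<close> with \<open>B = O(ln q)\<close>.  For a real perturbation \<open>\<tau>\<^sub>j\<close> of this kind,
  the integral of \<open>P\<close> against the product of the \<open>\<nu>\<^sub>j + x \<tau>\<^sub>j\<close> is a polynomial in \<open>x\<close> of
  degree at most \<open>d\<close>, and for small real \<open>x\<close> it is an average of values of \<open>P\<close> on the grid;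
  Bernstein's growth estimate then bounds it at complex \<open>x\<close>.  The weights \<open>\<sigma>\<^sub>j\<close>
  themselves are complex, so one considers \<open>\<nu>\<^sub>j + \<sigma>\<^sub>j + b cnj \<sigma>\<^sub>j\<close>: for
  \<open>b = e\<^sup>2\<close> on the unit circle it equals \<open>\<nu>\<^sub>j + e (2 Re (cnj e \<sigma>\<^sub>j))\<close>, and the maximum
  principle in \<open>b\<close> reaches \<open>b = 0\<close>.
\<close>

section \<open>Growth of a polynomial away from a real interval\<close>

lemma norm_le_on_unit_disc:
  assumes "f holomorphic_on UNIV" and "\<And>w. cmod w = 1 \<Longrightarrow> cmod (f w) \<le> M" and "cmod z \<le> 1"
  shows "cmod (f z) \<le> M"
proof (rule maximum_modulus_frontier[of f "cball 0 1"])
  show "f holomorphic_on interior (cball 0 1)"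
    using assms(1) by (rule holomorphic_on_subset) simp
  show "continuous_on (closure (cball 0 1)) f"
    using assms(1) by (meson holomorphic_on_imp_continuous_on continuous_on_subset subset_UNIV)
qed (use assms in auto)

text \<open>The two solutions \<open>c + s\<close> and \<open>c - s\<close> of the quadratic
  equation for \<open>w\<close> have product 1, so one of them lies in the closed unit disc.\<close>

lemma Joukowski_preimage:
  obtains w :: complex where "w \<noteq> 0" "cmod w \<le> 1" "w + inverse w = 2 * c"
proof -
  define s where "s = csqrt (c\<^sup>2 - 1)"
  have prod: "(c + s) * (c - s) = 1"
    by (simp add: s_def algebra_simps flip: power2_eq_square)
  then have nz: "c + s \<noteq> 0" "c - s \<noteq> 0" and inv: "inverse (c + s) = c - s" "inverse (c - s) = c + s"
    by (auto intro: inverse_unique simp: mult.commute)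
  have "cmod (c + s) * cmod (c - s) = 1"
    using prod by (metis norm_mult norm_one)
  then have "cmod (c + s) \<le> 1 \<or> cmod (c - s) \<le> 1"
    by (smt (verit) mult_less_cancel_left1)
  then show ?thesis
    using that[of "c + s"] that[of "c - s"] nz inv by auto
qed

text \<open>The map sending \<open>w\<close> to \<open>\<rho> * (w + inverse w) / 2\<close> takes
  the unit circle into the interval where \<open>p\<close> is bounded, and multiplying by
  \<open>w ^ d\<close> removes the pole at 0. The maximum principle then applies at a preimage
  \<open>w\<close> of \<open>z\<close>. Dividing by \<open>w ^ d\<close> costs the power of
  \<open>cmod (inverse w)\<close>, which is estimated from
  \<open>inverse w = 2 * z / \<rho> - w\<close>.\<close>

lemma poly_Bernstein_growth:
  fixes p :: "complex poly" and \<rho> :: real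
  assumes deg: "degree p \<le> d" and "\<rho> > 0"
    and bound: "\<And>x::real. \<bar>x\<bar> \<le> \<rho> \<Longrightarrow> cmod (poly p (of_real x)) \<le> M"
  shows "cmod (poly p z) \<le> (2 * cmod z / \<rho> + 1) ^ d * M"
proof -
  obtain w where w: "w \<noteq> 0" "cmod w \<le> 1" "w + inverse w = 2 * (z / of_real \<rho>)"
    by (rule Joukowski_preimage)
  \<comment> \<open>The powers of \<open>inverse w\<close> are already cleared in this form, so
    \<open>f\<close> is holomorphic at 0 too.\<close>
  define f where "f = (\<lambda>w. \<Sum>k\<le>d. coeff p k * of_real \<rho> ^ k * ((w\<^sup>2 + 1) / 2) ^ k * w ^ (d - k))"
  have f: "f u = u ^ d * poly p (of_real \<rho> * ((u + inverse u) / 2))" if "u \<noteq> 0" for u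
  proof -
    have "poly p (of_real \<rho> * ((u + inverse u) / 2))
        = (\<Sum>k\<le>d. coeff p k * (of_real \<rho> * ((u + inverse u) / 2)) ^ k)"
      unfolding poly_altdef using deg
      by (intro sum.mono_neutral_left) (auto simp: coeff_eq_0)
    moreover have "coeff p k * of_real \<rho> ^ k * ((u\<^sup>2 + 1) / 2) ^ k * u ^ (d - k)
        = u ^ d * (coeff p k * (of_real \<rho> * ((u + inverse u) / 2)) ^ k)" if "k \<le> d" for k
    proof -
      have "(u\<^sup>2 + 1) / 2 = u * ((u + inverse u) / 2)"
        using \<open>u \<noteq> 0\<close> by (simp add: field_simps power2_eq_square)
      moreover have "u ^ d = u ^ k * u ^ (d - k)"
        using that by (simp flip: power_add)
      ultimately show ?thesis
        by (simp only: power_mult_distrib mult_ac)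
    qed
    ultimately show ?thesis
      unfolding f_def by (simp only: sum_distrib_left) (intro sum.cong; simp)
  qed
  have "cmod (f w) \<le> M"
  proof (rule norm_le_on_unit_disc[of f])
    show "f holomorphic_on UNIV"
      unfolding f_def by (intro holomorphic_intros) auto
    fix u assume u: "cmod u = 1"
    then have "u \<noteq> 0" by auto
    have "inverse u = cnj u"
      using u by (intro inverse_unique) (simp add: complex_norm_square [symmetric])
    then have "(u + inverse u) / 2 = of_real (Re u)"
      by (simp add: complex_eq_iff)
    moreover have "\<bar>\<rho> * Re u\<bar> \<le> \<rho>"
      using u abs_Re_le_cmod[of u] \<open>\<rho> > 0\<close> by (simp add: abs_mult)
    ultimately show "cmod (f u) \<le> M"
      using bound[of "\<rho> * Re u"] f[OF \<open>u \<noteq> 0\<close>] u by (simp add: norm_mult norm_power)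
  qed (use w in simp)
  moreover have "f w = w ^ d * poly p z"
    using f[OF w(1)] w(3) \<open>\<rho> > 0\<close> by simp
  ultimately have "cmod w ^ d * cmod (poly p z) \<le> M"
    by (simp add: norm_mult norm_power)
  then have "cmod (inverse w) ^ d * (cmod w ^ d * cmod (poly p z)) \<le> cmod (inverse w) ^ d * M"
    by (rule mult_left_mono) simp
  moreover have "cmod (inverse w) ^ d * cmod w ^ d = 1"
    using w(1) by (simp flip: power_mult_distrib add: norm_inverse)
  ultimately have "cmod (poly p z) \<le> cmod (inverse w) ^ d * M"
    by (simp add: mult.assoc [symmetric])
  also have "\<dots> \<le> (2 * cmod z / \<rho> + 1) ^ d * M"
  proof (intro mult_right_mono power_mono)
    have "inverse w = 2 * (z / of_real \<rho>) - w"
      using w(3) by (simp add: algebra_simps)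
    then have "cmod (inverse w) \<le> cmod (2 * (z / of_real \<rho>)) + cmod w"
      using norm_triangle_ineq4 by metis
    then show "cmod (inverse w) \<le> 2 * cmod z / \<rho> + 1"
      using w(2) \<open>\<rho> > 0\<close> by (simp add: norm_mult norm_divide)
    show "0 \<le> M"
      using order_trans[OF norm_ge_zero bound[of 0]] \<open>\<rho> > 0\<close> by simp
  qed simp
  finally show ?thesis .
qed

section \<open>Integration against product weights on a grid\<close>

definition weighted_sum ::
  "complex set \<Rightarrow> nat \<Rightarrow> (nat \<Rightarrow> complex \<Rightarrow> complex) \<Rightarrow> ((nat \<Rightarrow> complex) \<Rightarrow> complex) \<Rightarrow> complex"
  where "weighted_sum R N w P = (\<Sum>\<xi>\<in>cart_power R N. (\<Prod>j<N. w j (\<xi> j)) * P \<xi>)"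

lemma weighted_sum_linear:
  "weighted_sum R N w (\<lambda>z. c * f z + g z) = c * weighted_sum R N w f + weighted_sum R N w g"
  by (simp add: weighted_sum_def algebra_simps sum.distrib sum_distrib_left)

text \<open>Fubini for a product of one-variable functions. Since \<open>R\<close> lies in the unit
  circle, the grid avoids the region where \<open>torus_monomial\<close> is extended by 0.\<close>

lemma weighted_sum_monomial:
  assumes "finite R" "R \<subseteq> unit_circle"
  shows "weighted_sum R N w (torus_monomial N \<alpha>) = (\<Prod>j<N. \<Sum>\<xi>\<in>R. w j \<xi> * \<xi> ^ \<alpha> j)"
proof -
  have "cart_power R N \<subseteq> cart_power unit_circle N"
    using assms(2) unfolding cart_power_def by (intro PiE_mono) auto
  then have "weighted_sum R N w (torus_monomial N \<alpha>)
      = (\<Sum>\<xi>\<in>cart_power R N. \<Prod>j<N. w j (\<xi> j) * \<xi> j ^ \<alpha> j)"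
    unfolding weighted_sum_def torus_monomial_def
    by (intro sum.cong) (auto simp: prod.distrib)
  also have "\<dots> = (\<Prod>j<N. \<Sum>\<xi>\<in>R. w j \<xi> * \<xi> ^ \<alpha> j)"
    unfolding cart_power_def using assms(1) by (intro prod_sum_PiE [symmetric]) auto
  finally show ?thesis .
qed

lemma weighted_sum_convex_bound:
  assumes "finite R" and nonneg: "\<And>j \<xi>. j < N \<Longrightarrow> \<xi> \<in> R \<Longrightarrow> 0 \<le> w j \<xi>"
    and total: "\<And>j. j < N \<Longrightarrow> (\<Sum>\<xi>\<in>R. w j \<xi>) = 1"
    and bound: "\<And>\<xi>. \<xi> \<in> cart_power R N \<Longrightarrow> cmod (P \<xi>) \<le> M"
  shows "cmod (weighted_sum R N (\<lambda>j \<xi>. of_real (w j \<xi>)) P) \<le> M"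
proof -
  have "cmod (weighted_sum R N (\<lambda>j \<xi>. of_real (w j \<xi>)) P)
      \<le> (\<Sum>\<xi>\<in>cart_power R N. (\<Prod>j<N. w j (\<xi> j)) * M)"
    unfolding weighted_sum_def
  proof (rule sum_norm_le)
    fix \<xi> assume \<xi>: "\<xi> \<in> cart_power R N"
    then have "0 \<le> (\<Prod>j<N. w j (\<xi> j))"
      by (intro prod_nonneg) (auto simp: cart_power_def intro!: nonneg)
    then show "cmod ((\<Prod>j<N. of_real (w j (\<xi> j))) * P \<xi>) \<le> (\<Prod>j<N. w j (\<xi> j)) * M"
      using bound[OF \<xi>] by (simp add: norm_mult mult_left_mono flip: of_real_prod)
  qed
  also have "\<dots> = (\<Prod>j<N. \<Sum>\<xi>\<in>R. w j \<xi>) * M"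
    using prod_sum_PiE[of "{..<N}" "\<lambda>_. R" w] assms(1)
    by (simp add: cart_power_def sum_distrib_right)
  finally show ?thesis
    using total by simp
qed

lemma weighted_sum_holomorphic:
  assumes "\<And>j \<xi>. (\<lambda>b. w b j \<xi>) holomorphic_on A"
  shows "(\<lambda>b. weighted_sum R N (w b) P) holomorphic_on A"
  unfolding weighted_sum_def by (intro holomorphic_intros assms)

text \<open>
  Perturbing by weights of total mass 0 only affects the coordinates in the support of a
  monomial, whence the degree in \<open>x\<close> is at most \<open>d\<close> for every \<open>N\<close>.
\<close>

lemma weighted_sum_poly:
  assumes R: "finite R" "R \<subseteq> unit_circle" and P: "P \<in> poly_space d q N"
    and \<nu>: "\<And>j. j < N \<Longrightarrow> (\<Sum>\<xi>\<in>R. \<nu> j \<xi>) = 1"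
    and \<tau>: "\<And>j. j < N \<Longrightarrow> (\<Sum>\<xi>\<in>R. \<tau> j \<xi>) = 0"
  obtains p where "degree p \<le> d" "\<And>x. weighted_sum R N (\<lambda>j \<xi>. \<nu> j \<xi> + x * \<tau> j \<xi>) P = poly p x"
proof -
  have "\<exists>p. degree p \<le> d \<and> (\<forall>x. weighted_sum R N (\<lambda>j \<xi>. \<nu> j \<xi> + x * \<tau> j \<xi>) P = poly p x)"
    using P unfolding poly_space_def
  proof (induction rule: complex_fun.span_induct_alt)
    case base
    show ?case
      by (intro exI[of _ 0]) (simp add: weighted_sum_def zero_fun_def)
  next
    case (step c f g)
    then obtain \<alpha> p where \<alpha>: "f = torus_monomial N \<alpha>" "card (index_supp N \<alpha>) \<le> d"
      and p: "degree p \<le> d" "\<And>x. weighted_sum R N (\<lambda>j \<xi>. \<nu> j \<xi> + x * \<tau> j \<xi>) g = poly p x"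
      by blast
    define l where "l j = [:\<Sum>\<xi>\<in>R. \<nu> j \<xi> * \<xi> ^ \<alpha> j, \<Sum>\<xi>\<in>R. \<tau> j \<xi> * \<xi> ^ \<alpha> j:]" for j
    define r where "r = (\<Prod>j\<in>index_supp N \<alpha>. l j)"
    have "degree r \<le> (\<Sum>j\<in>index_supp N \<alpha>. degree (l j))"
      unfolding r_def
      using degree_prod_sum_le[of "index_supp N \<alpha>" l] by (simp add: index_supp_def comp_def)
    also have "\<dots> \<le> (\<Sum>j\<in>index_supp N \<alpha>. 1)"
      by (intro sum_mono) (auto simp: l_def)
    finally have r: "degree r \<le> d"
      using \<alpha>(2) by simp
    have "weighted_sum R N (\<lambda>j \<xi>. \<nu> j \<xi> + x * \<tau> j \<xi>) f = poly r x" for x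
    proof -
      have "weighted_sum R N (\<lambda>j \<xi>. \<nu> j \<xi> + x * \<tau> j \<xi>) f = (\<Prod>j<N. poly (l j) x)"
        unfolding \<alpha>(1) weighted_sum_monomial[OF R] l_def
        by (simp add: algebra_simps sum.distrib sum_distrib_left)
      also have "\<dots> = (\<Prod>j\<in>index_supp N \<alpha>. poly (l j) x)"
        \<comment> \<open>Off the support the exponent is 0, so the coefficients of
          \<open>l j\<close> are the total masses 1 and 0.\<close>
        by (rule prod.mono_neutral_right) (auto simp: index_supp_def l_def \<nu> \<tau>)
      finally show ?thesis
        by (simp add: r_def poly_prod)
    qed
    then show ?case
      using p r
      by (intro exI[of _ "smult c r + p"])
        (auto simp: weighted_sum_linear plus_fun_def fun_scale_def intro!: degree_add_le order.trans[OF degree_smult_le])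
  qed
  then show thesis
    using that by blast
qed

lemma weighted_sum_growth:
  fixes \<nu> :: "nat \<Rightarrow> complex \<Rightarrow> real" and \<sigma> :: "nat \<Rightarrow> complex \<Rightarrow> complex"
  assumes R: "finite R" "R \<subseteq> unit_circle" and P: "P \<in> poly_space d q N"
    and \<nu>: "\<And>j. j < N \<Longrightarrow> (\<Sum>\<xi>\<in>R. \<nu> j \<xi>) = 1"
    and \<sigma>: "\<And>j. j < N \<Longrightarrow> (\<Sum>\<xi>\<in>R. \<sigma> j \<xi>) = 0"
    and B: "B > 0" "\<And>j \<xi>. j < N \<Longrightarrow> \<xi> \<in> R \<Longrightarrow> cmod (\<sigma> j \<xi>) \<le> B * \<nu> j \<xi>"
    and M: "\<And>\<xi>. \<xi> \<in> cart_power R N \<Longrightarrow> cmod (P \<xi>) \<le> M"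
  shows "cmod (weighted_sum R N (\<lambda>j \<xi>. of_real (\<nu> j \<xi>) + \<sigma> j \<xi>) P) \<le> (4 * B + 1) ^ d * M"
proof -
  \<comment> \<open>The wanted value is \<open>f 0\<close>. Conjugation falls on the fixed weights
    and not on \<open>b\<close>, so \<open>f\<close> is holomorphic.\<close>
  define f where
    "f b = weighted_sum R N (\<lambda>j \<xi>. of_real (\<nu> j \<xi>) + \<sigma> j \<xi> + b * cnj (\<sigma> j \<xi>)) P" for b
  have "cmod (f 0) \<le> (4 * B + 1) ^ d * M"
  proof (rule norm_le_on_unit_disc[of f])
    show "f holomorphic_on UNIV"
      unfolding f_def by (intro weighted_sum_holomorphic holomorphic_intros)
    fix b :: complex assume b: "cmod b = 1"
    define e where "e = csqrt b"
    have e2: "e * e = b"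
      by (simp add: e_def flip: power2_eq_square)
    have e: "cmod e = 1"
      using b by (simp add: e_def)
    have ee: "e * cnj e = 1"
      using e by (simp add: complex_norm_square [symmetric])
    define \<tau> where "\<tau> j \<xi> = 2 * Re (cnj e * \<sigma> j \<xi>)" for j \<xi>
    have \<tau>e: "e * of_real (\<tau> j \<xi>) = \<sigma> j \<xi> + b * cnj (\<sigma> j \<xi>)" for j \<xi>
    proof -
      have "of_real (\<tau> j \<xi>) = cnj e * \<sigma> j \<xi> + e * cnj (\<sigma> j \<xi>)"
        using complex_add_cnj[of "cnj e * \<sigma> j \<xi>"] by (simp add: \<tau>_def)
      then have "e * of_real (\<tau> j \<xi>) = (e * cnj e) * \<sigma> j \<xi> + (e * e) * cnj (\<sigma> j \<xi>)"
        by (simp only: algebra_simps)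
      then show ?thesis
        by (simp add: ee e2)
    qed
    have \<tau>0: "(\<Sum>\<xi>\<in>R. \<tau> j \<xi>) = 0" if "j < N" for j
    proof -
      have "(\<Sum>\<xi>\<in>R. \<tau> j \<xi>) = 2 * Re (cnj e * (\<Sum>\<xi>\<in>R. \<sigma> j \<xi>))"
        by (simp only: \<tau>_def sum_distrib_left Re_sum)
      then show ?thesis
        using \<sigma>[OF that] by simp
    qed
    obtain p where p: "degree p \<le> d"
      "\<And>x. weighted_sum R N (\<lambda>j \<xi>. of_real (\<nu> j \<xi>) + x * of_real (\<tau> j \<xi>)) P = poly p x"
    proof (rule weighted_sum_poly[OF R P])
      show "(\<Sum>\<xi>\<in>R. complex_of_real (\<nu> j \<xi>)) = 1" if "j < N" for j
        using \<nu>[OF that] by (metis of_real_1 of_real_sum)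
      show "(\<Sum>\<xi>\<in>R. complex_of_real (\<tau> j \<xi>)) = 0" if "j < N" for j
        using \<tau>0[OF that] by (metis of_real_0 of_real_sum)
    qed (use that in blast)
    \<comment> \<open>The radius \<open>1 / (2 * B)\<close> is chosen because
      \<open>\<bar>\<tau>\<bar> \<le> 2 * B * \<nu>\<close>, which keeps
      \<open>\<nu> + x * \<tau>\<close> nonnegative. At \<open>cmod e = 1\<close> the growth factor
      becomes \<open>4 * B + 1\<close>.\<close>
    have "cmod (poly p e) \<le> (2 * cmod e / (1 / (2 * B)) + 1) ^ d * M"
    proof (rule poly_Bernstein_growth[OF p(1)])
      fix x :: real assume x: "\<bar>x\<bar> \<le> 1 / (2 * B)"
      have "cmod (weighted_sum R N (\<lambda>j \<xi>. of_real (\<nu> j \<xi> + x * \<tau> j \<xi>)) P) \<le> M"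
      proof (rule weighted_sum_convex_bound[OF R(1)])
        fix j \<xi> assume j: "j < N" and \<xi>: "\<xi> \<in> R"
        have "\<bar>\<tau> j \<xi>\<bar> \<le> 2 * cmod (cnj e * \<sigma> j \<xi>)"
          using abs_Re_le_cmod[of "cnj e * \<sigma> j \<xi>"] by (simp add: \<tau>_def abs_mult)
        also have "\<dots> \<le> 2 * B * \<nu> j \<xi>"
          using B(2)[OF j \<xi>] e by (simp add: norm_mult)
        finally have "\<bar>x * \<tau> j \<xi>\<bar> \<le> 1 / (2 * B) * (2 * B * \<nu> j \<xi>)"
          unfolding abs_mult using x B(1) by (intro mult_mono) auto
        then show "0 \<le> \<nu> j \<xi> + x * \<tau> j \<xi>"
          using B(1) by simp
      next
        fix j assume "j < N"
        then show "(\<Sum>\<xi>\<in>R. \<nu> j \<xi> + x * \<tau> j \<xi>) = 1"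
          by (simp add: sum.distrib \<nu> \<tau>0 flip: sum_distrib_left)
      qed (rule M)
      then show "cmod (poly p (of_real x)) \<le> M"
        by (simp flip: p(2))
    qed (use B(1) in simp)
    moreover have "f b = poly p e"
      by (simp only: f_def \<tau>e add.assoc flip: p(2))
    ultimately show "cmod (f b) \<le> (4 * B + 1) ^ d * M"
      using e by simp
  qed simp
  then show ?thesis
    by (simp add: f_def)
qed

section \<open>Roots of unity and the interpolation kernel\<close>

lemma roots_of_one_eq:
  assumes "q > 0"
  shows "roots_of_one q = {z. z ^ q = 1}"
proof -
  have "exp (2 * of_real pi * \<i> * of_nat j / of_nat q) = cis (2 * pi * real j / real q)" for j
    by (simp add: cis_conv_exp mult.commute mult.left_commute)
  then show ?thesis
    using bij_betw_imp_surj_on[OF Complex.bij_betw_roots_unity[OF assms]]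
    by (simp only: roots_of_one_def)
qed

lemma sum_roots_of_one:
  assumes "q > 0"
  shows "(\<Sum>\<xi>\<in>roots_of_one q. f \<xi>) = (\<Sum>j<q. f (cis (2 * pi * real j / real q)))"
  using sum.reindex_bij_betw[OF Complex.bij_betw_roots_unity[OF assms], of f] assms
  by (simp add: roots_of_one_eq)

lemma finite_roots_of_one: "finite (roots_of_one q)"
  by (simp add: roots_of_one_def)

text \<open>Conjugation inverts roots of unity, so \<open>\<xi> \<mapsto> \<eta> * cnj \<xi>\<close>
  is an involution of the group.\<close>

lemma sum_roots_of_one_reflect:
  assumes "\<eta> \<in> roots_of_one q"
  shows "(\<Sum>\<xi>\<in>roots_of_one q. f (\<eta> * cnj \<xi>)) = (\<Sum>\<xi>\<in>roots_of_one q. f \<xi>)"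
proof -
  have q: "q > 0"
    using assms by (auto simp: roots_of_one_def)
  have unit: "\<xi> * cnj \<xi> = 1" if "\<xi> \<in> roots_of_one q" for \<xi>
    using that roots_of_one_subset[of q] by (auto simp: unit_circle_def simp flip: complex_norm_square)
  have inv: "\<eta> * cnj (\<eta> * cnj \<xi>) = \<xi>" for \<xi>
    using unit[OF assms] by (simp add: mult.assoc [symmetric])
  have mem: "\<eta> * cnj \<xi> \<in> roots_of_one q" if "\<xi> \<in> roots_of_one q" for \<xi>
    using that assms unfolding roots_of_one_eq[OF q]
    by (simp add: power_mult_distrib flip: complex_cnj_power)
  show ?thesis
    by (rule sum.reindex_bij_witness[of _ "\<lambda>\<xi>. \<eta> * cnj \<xi>" "\<lambda>\<xi>. \<eta> * cnj \<xi>"])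
      (use inv mem in auto)
qed

text \<open>A one-sided Dirichlet kernel: at \<open>u = z * cnj \<xi>\<close> it is the Lagrange
  basis polynomial in \<open>z\<close> for the node \<open>\<xi>\<close> among the
  \<open>q\<close>-th roots of unity.\<close>

definition interp_kernel :: "nat \<Rightarrow> complex \<Rightarrow> complex"
  where "interp_kernel q u = (\<Sum>k<q. u ^ k) / of_nat q"

text \<open>Orthogonality of characters. Since \<open>\<omega> j ^ k = \<omega> k ^ j\<close>, the
  sum is geometric with a ratio \<open>r\<close> satisfying \<open>r ^ q = 1\<close>, and
  \<open>r = 1\<close> only for \<open>k = m\<close>.\<close>

lemma sum_roots_of_one_character:
  assumes "k < q" "m < q"
  shows "(\<Sum>\<xi>\<in>roots_of_one q. cnj \<xi> ^ k * \<xi> ^ m) = (if k = m then of_nat q else 0)"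
proof -
  have q: "q > 0" using assms by simp
  define \<omega> where "\<omega> j = cis (2 * pi * real j / real q)" for j
  have \<omega>: "bij_betw \<omega> {..<q} {z. z ^ q = 1}"
    unfolding \<omega>_def by (rule Complex.bij_betw_roots_unity[OF q])
  have \<omega>_mult: "\<omega> i ^ j = cis (2 * pi * real (i * j) / real q)" for i j
    by (simp add: \<omega>_def Complex.DeMoivre mult_ac)
  have unit: "cnj (\<omega> i) * \<omega> i = 1" for i
    by (simp add: \<omega>_def cis_cnj cis_mult)
  define r where "r = cnj (\<omega> k) * \<omega> m"
  have "(\<Sum>\<xi>\<in>roots_of_one q. cnj \<xi> ^ k * \<xi> ^ m) = (\<Sum>j<q. cnj (\<omega> j) ^ k * \<omega> j ^ m)"
    by (simp add: sum_roots_of_one[OF q] \<omega>_def)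
  also have "\<dots> = (\<Sum>j<q. r ^ j)"
  proof (rule sum.cong)
    fix j
    have "cnj (\<omega> j ^ k) * \<omega> j ^ m = cnj (\<omega> k ^ j) * \<omega> m ^ j"
      by (simp add: \<omega>_mult mult.commute del: complex_cnj_power)
    then show "cnj (\<omega> j) ^ k * \<omega> j ^ m = r ^ j"
      by (simp add: r_def power_mult_distrib)
  qed simp
  also have "\<dots> = (if k = m then of_nat q else 0)"
  proof (cases "k = m")
    case True
    then show ?thesis by (simp add: r_def unit)
  next
    case False
    have "r \<noteq> 1"
    proof
      assume "r = 1"
      have "\<omega> k = \<omega> k * r"
        using \<open>r = 1\<close> by simp
      also have "\<dots> = (cnj (\<omega> k) * \<omega> k) * \<omega> m"
        by (simp add: r_def mult_ac)
      finally have "\<omega> k = \<omega> m"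
        by (simp add: unit)
      then show False
        using bij_betw_imp_inj_on[OF \<omega>] assms False by (auto dest: inj_onD)
    qed
    moreover have "\<omega> i ^ q = 1" if "i < q" for i
      using bij_betwE[OF \<omega>] that by auto
    then have "r ^ q = 1"
      using assms by (simp add: r_def power_mult_distrib flip: complex_cnj_power)
    ultimately show ?thesis
      using False by (simp add: geometric_sum)
  qed
  finally show ?thesis .
qed

lemma interp_kernel_reproduces:
  assumes "m < q"
  shows "(\<Sum>\<xi>\<in>roots_of_one q. interp_kernel q (z * cnj \<xi>) * \<xi> ^ m) = z ^ m"
proof -
  have "(\<Sum>\<xi>\<in>roots_of_one q. interp_kernel q (z * cnj \<xi>) * \<xi> ^ m)
      = (\<Sum>\<xi>\<in>roots_of_one q. \<Sum>k<q. z ^ k / of_nat q * (cnj \<xi> ^ k * \<xi> ^ m))"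
    unfolding interp_kernel_def sum_divide_distrib sum_distrib_right
    by (simp add: power_mult_distrib mult_ac)
  also have "\<dots> = (\<Sum>k<q. z ^ k / of_nat q * (\<Sum>\<xi>\<in>roots_of_one q. cnj \<xi> ^ k * \<xi> ^ m))"
    by (subst sum.swap) (simp add: sum_distrib_left)
  also have "\<dots> = (\<Sum>k<q. if k = m then z ^ k else 0)"
    using assms by (intro sum.cong) (auto simp: sum_roots_of_one_character)
  finally show ?thesis
    using assms by simp
qed

lemma interp_kernel_norm_le_1:
  assumes "cmod u = 1"
  shows "cmod (interp_kernel q u) \<le> 1"
proof (cases "q = 0")
  case False
  have "cmod (\<Sum>k<q. u ^ k) \<le> (\<Sum>k<q. 1)"
    by (rule sum_norm_le) (simp add: assms norm_power)
  then show ?thesis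
    using False by (simp add: interp_kernel_def norm_divide)
qed (simp add: interp_kernel_def)

section \<open>Logarithmic bound for the Lebesgue constant\<close>

text \<open>The quadratic minorant vanishes at both ends, and its reciprocal splits into the partial
  fractions \<open>1 / u + 1 / (1 - u)\<close>, which is what the kernel estimate uses.\<close>

lemma sin_pi_ge:
  fixes u :: real
  assumes "0 \<le> u" "u \<le> 1"
  shows "u * (1 - u) \<le> sin (pi * u)"
proof -
  have half: "v \<le> sin (pi * v)" if v: "0 \<le> v" "v \<le> 1 / 2" for v :: real
  proof -
    define x where "x = pi * v"
    have x: "0 \<le> x" "x \<le> 2"
      using v pi_less_4 mult_mono[of pi 4 v "1/2"] by (auto simp: x_def)
    \<comment> \<open>The cubic error is at most \<open>2 * x / 3\<close> for
      \<open>x \<le> 2\<close>. This leaves \<open>x / 3\<close>, which dominates \<open>v\<close>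
      because \<open>pi > 3\<close>.\<close>
    have "\<bar>sin x - (\<Sum>m<3. sin_coeff m * x ^ m)\<bar> \<le> inverse (fact 3) * \<bar>x\<bar> ^ 3"
      by (rule Maclaurin_sin_bound)
    then have "\<bar>sin x - x\<bar> \<le> x * (x * x) / 6"
      using x by (simp add: sin_coeff_def eval_nat_numeral)
    also have "\<dots> \<le> x * (2 * 2) / 6"
      using x by (intro divide_right_mono mult_left_mono mult_mono) auto
    finally have "x / 3 \<le> sin x"
      by linarith
    moreover have "3 * v \<le> x"
      unfolding x_def using pi_gt3 v by (intro mult_right_mono) auto
    ultimately show ?thesis
      unfolding x_def by linarith
  qed
  show ?thesis
  proof (cases "u \<le> 1 / 2")
    case True
    have "u * (1 - u) \<le> u" using assms by (simp add: mult_left_le)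
    then show ?thesis using half[of u] assms True by linarith
  next
    case False
    have "u * (1 - u) \<le> 1 - u" using assms by (simp add: mult_left_le_one_le)
    moreover have "sin (pi * (1 - u)) = sin (pi * u)"
      by (simp add: right_diff_distrib)
    ultimately show ?thesis using half[of "1 - u"] assms False by linarith
  qed
qed

text \<open>In the closed form of the geometric sum the numerator has modulus at most 2, while
  \<open>cmod (u - 1)\<close> is a chord of length \<open>2 * sin (pi * s)\<close>.\<close>

lemma interp_kernel_norm_le:
  assumes "q > 0" "0 < y" "y < real q"
  shows "cmod (interp_kernel q (cis (2 * pi * y / real q))) \<le> 1 / y + 1 / (real q - y)"
proof -
  define u where "u = cis (2 * pi * y / real q)"
  define s where "s = y / real q"
  have s: "0 < s" "s < 1"
    using assms by (auto simp: s_def)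
  have "0 < s * (1 - s)" using s by simp
  then have pos: "0 < sin (pi * s)"
    using sin_pi_ge[of s] s by linarith
  have "cmod (u - 1) = 2 * sin (pi * s)"
    using dist_exp_i_1[of "2 * pi * y / real q"] pos by (simp add: u_def s_def cis_conv_exp)
  then have u1: "cmod (u - 1) \<ge> 2 * (s * (1 - s))" "u \<noteq> 1"
    using sin_pi_ge[of s] s pos by auto
  have "cmod (interp_kernel q u) = cmod (u ^ q - 1) / (cmod (u - 1) * real q)"
    using u1(2) by (simp add: interp_kernel_def geometric_sum norm_divide norm_mult)
  also have "\<dots> \<le> 2 / (2 * (s * (1 - s)) * real q)"
  proof (rule frac_le)
    have "cmod (u ^ q - 1) \<le> cmod (u ^ q) + cmod 1"
      by (rule norm_triangle_ineq4)
    then show "cmod (u ^ q - 1) \<le> 2"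
      by (simp add: u_def norm_power)
    show "0 < 2 * (s * (1 - s)) * real q"
      using s assms by simp
    show "2 * (s * (1 - s)) * real q \<le> cmod (u - 1) * real q"
      using u1(1) by (rule mult_right_mono) simp
  qed simp
  also have "\<dots> = 1 / y + 1 / (real q - y)"
    using assms by (simp add: s_def field_simps)
  finally show ?thesis
    by (simp add: u_def)
qed

lemma Lebesgue_constant_shift:
  assumes q: "q \<ge> 2" and \<tau>: "0 \<le> \<tau>" "\<tau> < 1"
  shows "(\<Sum>i<q. cmod (interp_kernel q (cis (2 * pi * (real i + \<tau>) / real q)))) \<le> 4 + 2 * ln (real q)"
proof -
  define K where "K i = cmod (interp_kernel q (cis (2 * pi * (real i + \<tau>) / real q)))" for i
  have K1: "K i \<le> 1" for i
    unfolding K_def by (rule interp_kernel_norm_le_1) simp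
  \<comment> \<open>The two end terms may lie next to the peak of the kernel and get the trivial
    bound 1. For \<open>q = 2\<close> the middle range is empty.\<close>
  have split: "{..<q} = insert 0 (insert (q - 1) {1..q - 2})"
    using q by auto
  have "(\<Sum>i<q. K i) = K 0 + K (q - 1) + (\<Sum>i=1..q - 2. K i)"
  proof -
    have "0 \<notin> insert (q - 1) {1..q - 2}" "q - 1 \<notin> {1..q - 2}"
      using q by auto
    then show ?thesis
      unfolding split by simp
  qed
  moreover have "(\<Sum>i=1..q - 2. K i) \<le> (\<Sum>i=1..q - 2. 1 / real i + 1 / real (q - 1 - i))"
  proof (rule sum_mono)
    fix i assume i: "i \<in> {1..q - 2}"
    have "K i \<le> 1 / (real i + \<tau>) + 1 / (real q - (real i + \<tau>))"
      unfolding K_def by (rule interp_kernel_norm_le) (use i \<tau> q in auto)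
    \<comment> \<open>The shift \<open>\<tau> < 1\<close> costs one unit in the second denominator,
      which stays positive because \<open>i \<le> q - 2\<close>.\<close>
    also have "\<dots> \<le> 1 / real i + 1 / real (q - 1 - i)"
      using i \<tau> q by (intro add_mono divide_left_mono) (auto simp: of_nat_diff)
    finally show "K i \<le> 1 / real i + 1 / real (q - 1 - i)" .
  qed
  moreover have "(\<Sum>i=1..q - 2. 1 / real (q - 1 - i)) = (\<Sum>i=1..q - 2. 1 / real i)"
    by (rule sum.reindex_bij_witness[of _ "\<lambda>i. q - 1 - i" "\<lambda>i. q - 1 - i"]) (use q in auto)
  moreover have "(\<Sum>i=1..q - 2. 1 / real i) \<le> harm q"
    unfolding harm_def by (subst inverse_eq_divide, intro sum_mono2) auto
  \<comment> \<open>The sequence \<open>harm n - ln n\<close> decreases from its value 1 at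
    \<open>n = 1\<close>.\<close>
  moreover have "harm q \<le> ln (real q) + 1"
    using euler_mascheroni_sequence_decreasing[of 1 q] q by (simp add: harm_expand)
  ultimately show ?thesis
    using K1[of 0] K1[of "q - 1"] by (simp add: sum.distrib K_def)
qed

text \<open>Rotating by the node \<open>\<eta>\<close> that precedes \<open>z\<close> permutes the
  nodes, so only the offset \<open>\<tau>\<close> of \<open>z\<close> within its arc
  matters.\<close>

lemma Lebesgue_constant:
  assumes q: "q \<ge> 2" and z: "cmod z = 1"
  shows "(\<Sum>\<xi>\<in>roots_of_one q. cmod (interp_kernel q (z * cnj \<xi>))) \<le> 4 + 2 * ln (real q)"
proof -
  obtain t where t: "0 \<le> t" "t < 2 * pi" "z = cis t"
    using complex_unimodular_polar[OF z] by (metis cis.code complex_eq_iff)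
  \<comment> \<open>Angle of \<open>z\<close> in units of the node spacing
    \<open>2 * pi / q\<close>.\<close>
  define x where "x = real q * t / (2 * pi)"
  define m where "m = nat \<lfloor>x\<rfloor>"
  define \<tau> where "\<tau> = x - real m"
  have x: "0 \<le> x" "x < real q"
    using t q by (auto simp: x_def field_simps)
  have \<tau>: "0 \<le> \<tau>" "\<tau> < 1"
    using x by (auto simp: \<tau>_def m_def) linarith+
  have "m < q"
    using x \<tau> unfolding \<tau>_def by linarith
  define \<eta> where "\<eta> = cis (2 * pi * real m / real q)"
  have \<eta>: "\<eta> \<in> roots_of_one q"
    using q \<open>m < q\<close> bij_betwE[OF Complex.bij_betw_roots_unity[of q]] by (auto simp: roots_of_one_eq \<eta>_def)
  have zeta: "z = cis (2 * pi * \<tau> / real q) * \<eta>"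
    using q by (simp add: t(3) \<eta>_def cis_mult \<tau>_def x_def field_simps)
  have "(\<Sum>\<xi>\<in>roots_of_one q. cmod (interp_kernel q (z * cnj \<xi>)))
      = (\<Sum>\<xi>\<in>roots_of_one q. cmod (interp_kernel q (cis (2 * pi * \<tau> / real q) * \<xi>)))"
    using sum_roots_of_one_reflect[OF \<eta>, of "\<lambda>\<xi>. cmod (interp_kernel q (cis (2 * pi * \<tau> / real q) * \<xi>))"]
    by (simp add: zeta mult.assoc)
  also have "\<dots> = (\<Sum>i<q. cmod (interp_kernel q (cis (2 * pi * (real i + \<tau>) / real q))))"
    using q by (simp add: sum_roots_of_one cis_mult algebra_simps add_divide_distrib)
  also have "\<dots> \<le> 4 + 2 * ln (real q)"
    using q \<tau> by (rule Lebesgue_constant_shift)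
  finally show ?thesis .
qed

section \<open>Interpolation on the grid and the final estimate\<close>

text \<open>Interpolation is exact in each coordinate because every exponent is below
  \<open>q\<close>, and weights and monomials both factor over coordinates.\<close>

lemma weighted_sum_interp_kernel:
  assumes P: "P \<in> poly_space d q N" and z: "z \<in> cart_power unit_circle N"
  shows "weighted_sum (roots_of_one q) N (\<lambda>j \<xi>. interp_kernel q (z j * cnj \<xi>)) P = P z"
  using P unfolding poly_space_def
proof (induction rule: complex_fun.span_induct_alt)
  case base
  show ?case
    by (simp add: weighted_sum_def zero_fun_def)
next
  case (step c f g)
  then obtain \<alpha> where \<alpha>: "f = torus_monomial N \<alpha>" "\<alpha> \<in> multi_indices q N"
    by blast
  have "weighted_sum (roots_of_one q) N (\<lambda>j \<xi>. interp_kernel q (z j * cnj \<xi>)) f = (\<Prod>j<N. z j ^ \<alpha> j)"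
    unfolding \<alpha>(1) weighted_sum_monomial[OF finite_roots_of_one roots_of_one_subset]
    using \<alpha>(2) by (intro prod.cong) (auto simp: multi_indices_def intro!: interp_kernel_reproduces)
  also have "\<dots> = f z"
    using z by (simp add: \<alpha>(1) torus_monomial_def)
  finally show ?case
    using step.IH by (simp add: weighted_sum_linear plus_fun_def fun_scale_def)
qed

lemma poly_space_torus_bound:
  assumes q: "q \<ge> 2" and P: "P \<in> poly_space d q N" and z: "z \<in> cart_power unit_circle N"
    and M: "\<And>\<xi>. \<xi> \<in> cart_power (roots_of_one q) N \<Longrightarrow> cmod (P \<xi>) \<le> M"
  shows "cmod (P z) \<le> (21 + 8 * ln (real q)) ^ d * M"
proof -
  define R where "R = roots_of_one q"
  define w where "w j \<xi> = interp_kernel q (z j * cnj \<xi>)" for j \<xi>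
  define a where "a j = (\<Sum>\<xi>\<in>R. cmod (w j \<xi>))" for j
  define \<nu> where "\<nu> j \<xi> = cmod (w j \<xi>) / a j" for j \<xi>
  define \<sigma> where "\<sigma> j \<xi> = w j \<xi> - of_real (\<nu> j \<xi>)" for j \<xi>
  \<comment> \<open>The Lebesgue constant \<open>4 + 2 * ln q\<close> bounds \<open>a j\<close>, and
    subtracting \<open>\<nu>\<close> adds one more:
    \<open>cmod \<sigma> \<le> (a j + 1) * \<nu>\<close>. Then
    \<open>4 * B + 1 = 21 + 8 * ln q\<close>.\<close>
  define B where "B = 5 + 2 * ln (real q)"
  have w1: "(\<Sum>\<xi>\<in>R. w j \<xi>) = 1" for j
    using interp_kernel_reproduces[of 0 q "z j"] q by (simp add: w_def R_def)
  \<comment> \<open>Total mass 1 forces total variation at least 1, so the normalisation in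
    \<open>\<nu>\<close> divides by a nonzero number.\<close>
  have a1: "1 \<le> a j" for j
    using norm_sum[of "w j" R] by (simp add: w1 a_def)
  have \<nu>1: "(\<Sum>\<xi>\<in>R. \<nu> j \<xi>) = 1" for j
    using a1[of j] by (simp add: \<nu>_def flip: sum_divide_distrib a_def)
  have aB: "a j + 1 \<le> B" if "j < N" for j
    using Lebesgue_constant[OF q, of "z j"] z that
    by (auto simp: a_def w_def R_def B_def cart_power_def unit_circle_def PiE_iff)
  have "cmod (weighted_sum R N (\<lambda>j \<xi>. of_real (\<nu> j \<xi>) + \<sigma> j \<xi>) P) \<le> (4 * B + 1) ^ d * M"
  proof (rule weighted_sum_growth[OF _ _ P])
    show "finite R" "R \<subseteq> unit_circle"
      by (simp_all add: R_def finite_roots_of_one roots_of_one_subset)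
    show "(\<Sum>\<xi>\<in>R. \<nu> j \<xi>) = 1" for j
      by (rule \<nu>1)
    have "(\<Sum>\<xi>\<in>R. complex_of_real (\<nu> j \<xi>)) = 1" for j
      using \<nu>1[of j] by (metis of_real_1 of_real_sum)
    then show "(\<Sum>\<xi>\<in>R. \<sigma> j \<xi>) = 0" for j
      by (simp add: \<sigma>_def sum_subtractf w1)
    show "B > 0"
      using q by (simp add: B_def add_pos_nonneg)
    show "cmod (\<sigma> j \<xi>) \<le> B * \<nu> j \<xi>" if "j < N" for j \<xi>
    proof -
      have \<nu>0: "0 \<le> \<nu> j \<xi>"
        using a1[of j] by (simp add: \<nu>_def)
      have "cmod (\<sigma> j \<xi>) \<le> cmod (w j \<xi>) + \<nu> j \<xi>"
        unfolding \<sigma>_def using norm_triangle_ineq4[of "w j \<xi>" "of_real (\<nu> j \<xi>)"] \<nu>0 by simp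
      also have "\<dots> = (a j + 1) * \<nu> j \<xi>"
        using a1[of j] by (simp add: \<nu>_def field_simps)
      also have "\<dots> \<le> B * \<nu> j \<xi>"
        using aB[OF that] \<nu>0 by (rule mult_right_mono)
      finally show ?thesis .
    qed
    show "cmod (P \<xi>) \<le> M" if "\<xi> \<in> cart_power R N" for \<xi>
      using M that by (simp add: R_def)
  qed
  moreover have "weighted_sum R N (\<lambda>j \<xi>. of_real (\<nu> j \<xi>) + \<sigma> j \<xi>) P = P z"
    using weighted_sum_interp_kernel[OF P z] by (simp add: \<sigma>_def w_def R_def)
  ultimately show ?thesis
    by (simp add: B_def algebra_simps)
qed

theorem theorem2p2:
  shows "\<exists>C::real. C > 0 \<and>
    (\<forall>(q::nat) (d::nat) (N::nat). q \<ge> 2 \<longrightarrow> N \<ge> 1 \<longrightarrow>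
      (\<forall>P \<in> poly_space d q N.
        sup_norm_on (cart_power unit_circle N) P
          \<le> (C * ln (real q)) ^ d * sup_norm_on (cart_power (roots_of_one q) N) P))"
proof (intro exI[of _ "8 + 21 / ln 2"] conjI allI impI ballI)
  show "0 < 8 + 21 / ln (2::real)"
    by (simp add: add_pos_pos)
next
  fix q d N :: nat and P
  assume q: "q \<ge> 2" and P: "P \<in> poly_space d q N"
  define M where "M = sup_norm_on (cart_power (roots_of_one q) N) P"
  have ne: "cart_power (roots_of_one q) N \<noteq> {}" "cart_power unit_circle N \<noteq> {}"
    using norms_well_defined(1)[OF _ P] q by auto
  have M: "cmod (P \<xi>) \<le> M" if "\<xi> \<in> cart_power (roots_of_one q) N" for \<xi>
    unfolding M_def sup_norm_on_def by (rule cSUP_upper[OF that poly_space_bounded[OF P]])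
  have "M \<ge> 0"
    using ne(1) M norm_ge_zero order_trans by blast
  have "ln 2 \<le> ln (real q)"
    using q by simp
  \<comment> \<open>The additive 21 is absorbed using \<open>ln q \<ge> ln 2\<close>, which explains
    the witness \<open>8 + 21 / ln 2\<close>.\<close>
  then have "21 + 8 * ln (real q) \<le> (8 + 21 / ln 2) * ln (real q)"
    by (simp add: field_simps)
  then have "(21 + 8 * ln (real q)) ^ d * M \<le> ((8 + 21 / ln 2) * ln (real q)) ^ d * M"
    using q \<open>M \<ge> 0\<close> by (intro mult_right_mono power_mono) (auto intro: add_nonneg_nonneg)
  then have "cmod (P z) \<le> ((8 + 21 / ln 2) * ln (real q)) ^ d * M"
    if "z \<in> cart_power unit_circle N" for z
    using poly_space_torus_bound[OF q P that M] by linarith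
  then show "sup_norm_on (cart_power unit_circle N) P \<le> ((8 + 21 / ln 2) * ln (real q)) ^ d
      * sup_norm_on (cart_power (roots_of_one q) N) P"
    unfolding M_def [symmetric] unfolding sup_norm_on_def by (intro cSUP_least ne)
qed

end
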